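(* Let $Q_R$ be any projection on $\mathbb{R}^N$ and let $Q_L=AQ_RA^{-1}$. Suppose that the matrix $A^{-1}Q_L+P^{-1}(\mathrm{Id}-Q_L)$ is non-singular. Then the deflated fixed-point iterations $$\begin{cases} x^{(n+\frac12)}=x^{(n)}+Q_R(x^\infty-x^{(n)})\\ x^{(n+1)}=x^{(n+\frac12)}+P^{-1}A(\mathrm{Id}-Q_R)(x^\infty-x^{(n)})\end{cases}$$ can be formulated as the fixed-point (Richardson) iterations $$x^{(n+1)}=x^{(n)}+\underline{P}^{-1}A(x^\infty-x^{(n)})$$ with the new preconditioner $\underline{P}=\left(A^{-1}Q_L+P^{-1}(\mathrm{Id}-Q_L)\right)^{-1}$.
   Context: $A\in GL_N(\mathbb{R})$, $P\in GL_N(\mathbb{R})$ (the preconditioner), $b\in\mathbb{R}^N$, and $x^\infty$ is the solution of $Ax^\infty=b$. A projection is a linear map $Q_R$ with $Q_R^2=Q_R$. *)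

theory Defs
  imports "HOL-Analysis.Analysis"
begin

definition projection :: "(real^'n \<Rightarrow> real^'n) \<Rightarrow> bool" where
  "projection Q \<longleftrightarrow> linear Q \<and> Q \<circ> Q = Q"

(* The sequence xh holds the half steps: xh n stands for x^(n+1/2). *)
definition deflated_iterations ::
  "real^'n^'n \<Rightarrow> real^'n^'n \<Rightarrow> real^'n^'n \<Rightarrow> real^'n
    \<Rightarrow> (nat \<Rightarrow> real^'n) \<Rightarrow> (nat \<Rightarrow> real^'n) \<Rightarrow> bool" where
  "deflated_iterations A P Q_R x_inf x xh \<longleftrightarrow>
     (\<forall>n. xh n = x n + Q_R *v (x_inf - x n) \<and>
          x (Suc n) = xh n + (matrix_inv P ** A ** (mat 1 - Q_R)) *v (x_inf - x n))"

definition richardson_iterations ::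
  "real^'n^'n \<Rightarrow> real^'n^'n \<Rightarrow> real^'n \<Rightarrow> (nat \<Rightarrow> real^'n) \<Rightarrow> bool" where
  "richardson_iterations A P x_inf x \<longleftrightarrow>
     (\<forall>n. x (Suc n) = x n + (matrix_inv P ** A) *v (x_inf - x n))"

end

theory Submission
  imports Defs
begin

text \<open>
  Since \<open>Q_L\<close> is conjugate to \<open>Q_R\<close> by \<open>A\<close>, the two projections intertwine with \<open>A\<close>:
  \<open>Q_L A = A Q_R\<close>. Hence the matrix \<open>M = A\<inverse> Q_L + P\<inverse> (1 - Q_L)\<close> satisfies
  \<open>M A = Q_R + P\<inverse> A (1 - Q_R)\<close> (\<open>deflated_preconditioner_mult\<close>).

  The left-hand side is the matrix applied to the error in one Richardson step with
  preconditioner \<open>M\<inverse>\<close>. The right-hand side is the matrix applied to the error in one deflated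
  step after the half step is eliminated (\<open>ex_deflated_iterations_iff\<close>); both parts of the
  deflated step use the error of the same iterate, so this elimination is a plain substitution.
  The two recursions therefore coincide term by term.
\<close>

lemma matrix_diff_rdistrib:
  fixes A B :: "real^'n^'m" and C :: "real^'k^'n"
  shows "(A - B) ** C = A ** C - B ** C"
  by (simp add: vec_eq_iff matrix_matrix_mult_def left_diff_distrib sum_subtractf)

lemma matrix_diff_ldistrib:
  fixes A :: "real^'n^'m" and B C :: "real^'k^'n"
  shows "A ** (B - C) = A ** B - A ** C"
  by (simp add: vec_eq_iff matrix_matrix_mult_def right_diff_distrib sum_subtractf)

lemma matrix_add_rdistrib:
  fixes A B :: "real^'n^'m" and C :: "real^'k^'n"
  shows "(A + B) ** C = A ** C + B ** C"
  by (simp add: vec_eq_iff matrix_matrix_mult_def distrib_right sum.distrib)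

lemma
  fixes M :: "real^'n^'n"
  assumes "invertible M"
  shows matrix_inv_left: "matrix_inv M ** M = mat 1"
    and matrix_inv_right: "M ** matrix_inv M = mat 1"
  using someI_ex[OF assms[unfolded invertible_def]] by (simp_all add: matrix_inv_def)

lemma invertible_matrix_inv:
  fixes M :: "real^'n^'n"
  assumes "invertible M"
  shows "invertible (matrix_inv M)"
  using assms invertible_def matrix_inv_left matrix_inv_right by blast

lemma matrix_inv_matrix_inv:
  fixes M :: "real^'n^'n"
  assumes "invertible M"
  shows "matrix_inv (matrix_inv M) = M"
proof -
  let ?N = "matrix_inv M"
  have "matrix_inv ?N = matrix_inv ?N ** (?N ** M)"
    using assms by (simp add: matrix_inv_left)
  also have "\<dots> = matrix_inv ?N ** ?N ** M"
    by (rule matrix_mul_assoc)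
  also have "\<dots> = M"
    using assms by (simp add: matrix_inv_left invertible_matrix_inv)
  finally show ?thesis .
qed

text \<open>Moving \<open>A\<close> leftwards through \<open>Q_L\<close> turns it into \<open>Q_R\<close>, and the factor \<open>A\<inverse>\<close> in the
  first summand cancels the \<open>A\<close> that is moved.\<close>

lemma deflated_preconditioner_mult:
  fixes A P Q_R Q_L :: "real^'n^'n"
  assumes A: "invertible A" and Q_L: "Q_L = A ** Q_R ** matrix_inv A"
  shows "(matrix_inv A ** Q_L + matrix_inv P ** (mat 1 - Q_L)) ** A
    = Q_R + matrix_inv P ** A ** (mat 1 - Q_R)"
proof -
  have "Q_L ** A = A ** Q_R ** (matrix_inv A ** A)"
    unfolding Q_L by (simp only: matrix_mul_assoc)
  then have intertwine: "Q_L ** A = A ** Q_R"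
    using A by (simp add: matrix_inv_left)
  have "matrix_inv A ** Q_L ** A = matrix_inv A ** A ** Q_R"
    by (metis intertwine matrix_mul_assoc)
  then have first_part: "matrix_inv A ** Q_L ** A = Q_R"
    using A by (simp add: matrix_inv_left)
  have "(mat 1 - Q_L) ** A = A ** (mat 1 - Q_R)"
    by (simp add: matrix_diff_rdistrib matrix_diff_ldistrib intertwine)
  then have "matrix_inv P ** (mat 1 - Q_L) ** A = matrix_inv P ** A ** (mat 1 - Q_R)"
    by (metis matrix_mul_assoc)
  then show ?thesis
    by (simp add: matrix_add_rdistrib first_part)
qed

text \<open>The half steps are determined by the full steps, so they exist for every sequence and
  substituting them leaves a one-term recursion.\<close>

lemma ex_deflated_iterations_iff:
  "(\<exists>xh. deflated_iterations A P Q_R x_inf x xh) \<longleftrightarrow>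
    (\<forall>n. x (Suc n) = x n + (Q_R + matrix_inv P ** A ** (mat 1 - Q_R)) *v (x_inf - x n))"
    (is "?deflated \<longleftrightarrow> ?eliminated")
proof
  show ?eliminated if ?deflated
    using that unfolding deflated_iterations_def
    by (metis add.assoc matrix_vector_mult_add_rdistrib)
  show ?deflated if ?eliminated
    unfolding deflated_iterations_def
    by (rule exI[of _ "\<lambda>n. x n + Q_R *v (x_inf - x n)"])
      (use that in \<open>simp add: matrix_vector_mult_add_rdistrib add.assoc\<close>)
qed

theorem proposition1:
  fixes A P Q_R Q_L P_new :: "real^'n^'n" and b x_inf :: "real^'n"
  assumes "invertible A" and "invertible P"
    and "A *v x_inf = b"
    and "projection ((*v) Q_R)"
    and "Q_L = A ** Q_R ** matrix_inv A"
    and "invertible (matrix_inv A ** Q_L + matrix_inv P ** (mat 1 - Q_L))"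
    and "P_new = matrix_inv (matrix_inv A ** Q_L + matrix_inv P ** (mat 1 - Q_L))"
  shows "invertible P_new \<and>
    (\<forall>x. (\<exists>xh. deflated_iterations A P Q_R x_inf x xh)
          \<longleftrightarrow> richardson_iterations A P_new x_inf x)"
proof -
  have "invertible P_new"
    using assms(6,7) by (simp add: invertible_matrix_inv)
  moreover have "matrix_inv P_new ** A = Q_R + matrix_inv P ** A ** (mat 1 - Q_R)"
    using deflated_preconditioner_mult[OF assms(1,5)] assms(6,7)
    by (simp add: matrix_inv_matrix_inv)
  ultimately show ?thesis
    by (simp add: ex_deflated_iterations_iff richardson_iterations_def)
qed

end
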